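(* Let $(X,m,\rho)$ be a bounded complete Ahlfors $Q$-regular metric measure space with a fixed dyadic system, $T$ the associated tree, $\Lambda:\partial T\to X$ the associated map, and let $N(x)=\sharp\Lambda^{-1}(x)$ and $N_A(x)=\sharp(\Lambda^{-1}(x)\cap A)$ for $x\in X$, $A\subseteq\partial T$. For every nonnegative Borel measure $\omega$ on $X$, the set function $$\Lambda^*\omega(A)=\int_X\frac{N_A(x)}{N(x)}\,d\omega(x),\qquad A\subseteq\partial T\text{ Borel},$$ is a Borel measure on $\partial T$. Moreover: (i) $\Lambda_*(\Lambda^*\omega)=\omega$; (ii) with $N=\max\{N(x):x\in X\}$, for each Borel set $A\subseteq\partial T$, $\ \dfrac{\omega(\Lambda(A))}{N}\le\Lambda^*\omega(A)\le\omega(\Lambda(A))$; (iii) $\mathrm{supp}(\Lambda^*\omega)\subseteq\Lambda^{-1}(\mathrm{supp}(\omega))$; (iv) $\mathrm{supp}(\Lambda_*\nu)=\Lambda(\mathrm{supp}(\nu))$ for every nonnegative Borel measure $\nu$ on $\partial T$; (v) $\mathrm{supp}(\omega)\subseteq\Lambda(\mathrm{supp}(\Lambda^*\omega))$.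
   Context: Ahlfors regularity: $(X,\rho)$ is a complete metric space, $0<\mathrm{diam}(X)<\infty$, $m\ge0$ is Borel, and $c_1r^Q\le m(B(x,r))\le c_2r^Q$ for all $x\in X$, $0\le r\le\mathrm{diam}(X)$, with constants $0<c_1<c_2$, $Q>0$. Dyadic system (exists by a theorem of M. Christ, up to rescaling the distance): constants $\delta\in(0,1)$, $a_0,c_4>0$, index sets $I_k$ ($k\in\mathbb N=\{0,1,\dots\}$), and open sets $Q^k_\alpha\subseteq X$ ($\alpha\in I_k$) with: (i) $m(X\setminus\bigcup_{\alpha\in I_k}Q^k_\alpha)=0$ for all $k$; (ii) if $l\ge k$, $\alpha\in I_k$, $\beta\in I_l$, then $Q^l_\beta\subseteq Q^k_\alpha$ or $Q^l_\beta\cap Q^k_\alpha=\emptyset$, and distinct sets with the same $k$ are disjoint; (iii) for $l>k$ and $\beta\in I_l$ there is a unique $\alpha\in I_k$ with $Q^l_\beta\subseteq Q^k_\alpha$; (iv) $\mathrm{diam}(Q^k_\alpha)\le c_4\delta^k$; (v) $B(z^k_\alpha,a_0\delta^k)\subseteq Q^k_\alpha$ for a distinguished point $z^k_\alpha\in Q^k_\alpha$; moreover $I_0=\{o\}$ and $Q^0_o=X$. Tree $T$: vertices are the pairs $(k,\alpha)$, $\alpha\in I_k$ (written $\alpha$, level $d(\alpha)=k$, $Q_\alpha=Q^k_\alpha$), with root $o$; $\alpha,\beta$ are joined by an edge if $d(\beta)=d(\alpha)+1$ and $Q_\beta\subseteq Q_\alpha$, or vice versa. $\partial T$ is the set of infinite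 geodesics $\xi=(\xi_n)_{n\ge0}$ with $\xi_0=o$, $d(\xi_n)=n$, with the topology having as basis the sets $\partial S(\alpha)=\{\xi:\alpha\in\{\xi_n\}\}$. $\Lambda(\xi)$ is the unique point of $\bigcap_{n\ge0}\overline{Q_{\xi_n}}$. $\Lambda$ is continuous and onto, $N(x)$ is bounded on $X$, and $x\mapsto N_A(x)$ is Borel for Borel $A$. For a Borel measure $\nu$ on $\partial T$, $\Lambda_*\nu(E)=\nu(\Lambda^{-1}(E))$. *)

theory Defs
  imports "HOL-Analysis.Analysis"
begin

section \<open>Bounded complete Ahlfors regular spaces\<close>

text \<open>The space $X$ is the whole type \<^typ>\<open>'a\<close>; \<^const>\<open>ball\<close> is the open ball.\<close>

locale ahlfors_regular =
  fixes m :: "'a::complete_space measure" and Q c1 c2 :: real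
  assumes borel_m: "sets m = sets borel"
    and bounded_space: "bounded (UNIV :: 'a set)"
    and diameter_pos: "0 < diameter (UNIV :: 'a set)"
    and Q_pos: "0 < Q"
    and c1_pos: "0 < c1"
    and c1_less_c2: "c1 < c2"
    and regular_lower: "\<And>x r. 0 \<le> r \<Longrightarrow> r \<le> diameter (UNIV :: 'a set) \<Longrightarrow>
      ennreal (c1 * r powr Q) \<le> emeasure m (ball x r)"
    and regular_upper: "\<And>x r. 0 \<le> r \<Longrightarrow> r \<le> diameter (UNIV :: 'a set) \<Longrightarrow>
      emeasure m (ball x r) \<le> ennreal (c2 * r powr Q)"

section \<open>Dyadic systems\<close>

text \<open>\<^term>\<open>D k \<alpha>\<close> is the dyadic cube $Q^k_\alpha$, with distinguished point \<^term>\<open>z k \<alpha>\<close>;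
  \<^term>\<open>rt\<close> is the index $o$ of the single cube at level 0.\<close>

locale dyadic_system =
  fixes m :: "'a::complete_space measure"
    and I :: "nat \<Rightarrow> 'i set"
    and D :: "nat \<Rightarrow> 'i \<Rightarrow> 'a set"
    and z :: "nat \<Rightarrow> 'i \<Rightarrow> 'a"
    and rt :: 'i
    and \<delta> a0 c4 :: real
  assumes delta: "0 < \<delta>" "\<delta> < 1"
    and a0_pos: "0 < a0"
    and c4_pos: "0 < c4"
    and open_cube: "\<And>k \<alpha>. \<alpha> \<in> I k \<Longrightarrow> open (D k \<alpha>)"
    and full_measure: "\<And>k. emeasure m (UNIV - (\<Union>\<alpha>\<in>I k. D k \<alpha>)) = 0"
    and nested: "\<And>k l \<alpha> \<beta>. k \<le> l \<Longrightarrow> \<alpha> \<in> I k \<Longrightarrow> \<beta> \<in> I l \<Longrightarrow>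
      D l \<beta> \<subseteq> D k \<alpha> \<or> D l \<beta> \<inter> D k \<alpha> = {}"
    and disjoint: "\<And>k. disjoint_family_on (D k) (I k)"
    and unique_ancestor: "\<And>k l \<beta>. k < l \<Longrightarrow> \<beta> \<in> I l \<Longrightarrow>
      \<exists>!\<alpha>. \<alpha> \<in> I k \<and> D l \<beta> \<subseteq> D k \<alpha>"
    and diameter_cube: "\<And>k \<alpha>. \<alpha> \<in> I k \<Longrightarrow> diameter (D k \<alpha>) \<le> c4 * \<delta> ^ k"
    and centre: "\<And>k \<alpha>. \<alpha> \<in> I k \<Longrightarrow> z k \<alpha> \<in> D k \<alpha>"
    and ball_in_cube: "\<And>k \<alpha>. \<alpha> \<in> I k \<Longrightarrow> ball (z k \<alpha>) (a0 * \<delta> ^ k) \<subseteq> D k \<alpha>"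
    and level_0: "I 0 = {rt}" "D 0 rt = UNIV"

section \<open>The associated tree and its boundary\<close>

text \<open>A vertex is a pair \<open>(k, \<alpha>)\<close>; its level is its first component.\<close>

definition tree_vertices :: "(nat \<Rightarrow> 'i set) \<Rightarrow> (nat \<times> 'i) set" where
  "tree_vertices I = (SIGMA k:UNIV. I k)"

definition child_of ::
  "(nat \<Rightarrow> 'i \<Rightarrow> 'a set) \<Rightarrow> nat \<times> 'i \<Rightarrow> nat \<times> 'i \<Rightarrow> bool" where
  "child_of D w v \<longleftrightarrow> fst w = fst v + 1 \<and> D (fst w) (snd w) \<subseteq> D (fst v) (snd v)"

definition tree_edges ::
  "(nat \<Rightarrow> 'i set) \<Rightarrow> (nat \<Rightarrow> 'i \<Rightarrow> 'a set) \<Rightarrow> ((nat \<times> 'i) \<times> (nat \<times> 'i)) set" where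
  "tree_edges I D = {(v, w). v \<in> tree_vertices I \<and> w \<in> tree_vertices I \<and>
      (child_of D w v \<or> child_of D v w)}"

definition graph_dist :: "('v \<times> 'v) set \<Rightarrow> 'v \<Rightarrow> 'v \<Rightarrow> nat" where
  "graph_dist E v w = (LEAST n. (v, w) \<in> E ^^ n)"

definition geodesic_ray :: "('v \<times> 'v) set \<Rightarrow> (nat \<Rightarrow> 'v) \<Rightarrow> bool" where
  "geodesic_ray E \<xi> \<longleftrightarrow> (\<forall>n. (\<xi> n, \<xi> (Suc n)) \<in> E) \<and>
     (\<forall>i j. i \<le> j \<longrightarrow> graph_dist E (\<xi> i) (\<xi> j) = j - i)"

definition tree_boundary ::
  "(nat \<Rightarrow> 'i set) \<Rightarrow> (nat \<Rightarrow> 'i \<Rightarrow> 'a set) \<Rightarrow> 'i \<Rightarrow> (nat \<Rightarrow> nat \<times> 'i) set" where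
  "tree_boundary I D rt =
     {\<xi>. geodesic_ray (tree_edges I D) \<xi> \<and> \<xi> 0 = (0, rt) \<and> (\<forall>n. fst (\<xi> n) = n)}"

definition cylinder ::
  "(nat \<Rightarrow> 'i set) \<Rightarrow> (nat \<Rightarrow> 'i \<Rightarrow> 'a set) \<Rightarrow> 'i \<Rightarrow> nat \<times> 'i \<Rightarrow> (nat \<Rightarrow> nat \<times> 'i) set" where
  "cylinder I D rt v = {\<xi> \<in> tree_boundary I D rt. v \<in> range \<xi>}"

text \<open>Two cylinders of a dyadic system are nested or disjoint, so the cylinders generate the
  topology of which they are a basis.\<close>

definition boundary_topology ::
  "(nat \<Rightarrow> 'i set) \<Rightarrow> (nat \<Rightarrow> 'i \<Rightarrow> 'a set) \<Rightarrow> 'i \<Rightarrow> (nat \<Rightarrow> nat \<times> 'i) topology" where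
  "boundary_topology I D rt = topology_generated_by (cylinder I D rt ` tree_vertices I)"

lemma topspace_boundary_topology:
  "topspace (boundary_topology I D rt) = tree_boundary I D rt"
proof -
  have "\<xi> 0 \<in> tree_vertices I" if "\<xi> \<in> tree_boundary I D rt" for \<xi>
  proof -
    from that have "(\<xi> 0, \<xi> (Suc 0)) \<in> tree_edges I D"
      unfolding tree_boundary_def geodesic_ray_def by blast
    then show ?thesis by (simp add: tree_edges_def)
  qed
  then show ?thesis
    by (fastforce simp: boundary_topology_def cylinder_def)
qed

definition boundary_borel ::
  "(nat \<Rightarrow> 'i set) \<Rightarrow> (nat \<Rightarrow> 'i \<Rightarrow> 'a set) \<Rightarrow> 'i \<Rightarrow> (nat \<Rightarrow> nat \<times> 'i) measure" where
  "boundary_borel I D rt =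
     sigma (tree_boundary I D rt) {U. openin (boundary_topology I D rt) U}"

section \<open>The boundary map and its multiplicity\<close>

definition Lam ::
  "(nat \<Rightarrow> 'i \<Rightarrow> 'a::metric_space set) \<Rightarrow> (nat \<Rightarrow> nat \<times> 'i) \<Rightarrow> 'a" where
  "Lam D \<xi> = (THE x. x \<in> (\<Inter>n. closure (D (fst (\<xi> n)) (snd (\<xi> n)))))"

definition fibre_card_on ::
  "(nat \<Rightarrow> 'i set) \<Rightarrow> (nat \<Rightarrow> 'i \<Rightarrow> 'a::metric_space set) \<Rightarrow> 'i \<Rightarrow>
    (nat \<Rightarrow> nat \<times> 'i) set \<Rightarrow> 'a \<Rightarrow> nat" where
  "fibre_card_on I D rt A x = card {\<xi> \<in> tree_boundary I D rt \<inter> A. Lam D \<xi> = x}"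

definition fibre_card ::
  "(nat \<Rightarrow> 'i set) \<Rightarrow> (nat \<Rightarrow> 'i \<Rightarrow> 'a::metric_space set) \<Rightarrow> 'i \<Rightarrow> 'a \<Rightarrow> nat" where
  "fibre_card I D rt x = card {\<xi> \<in> tree_boundary I D rt. Lam D \<xi> = x}"

section \<open>Pull-back and support of measures\<close>

definition pullback_fun ::
  "(nat \<Rightarrow> 'i set) \<Rightarrow> (nat \<Rightarrow> 'i \<Rightarrow> 'a::metric_space set) \<Rightarrow> 'i \<Rightarrow> 'a measure \<Rightarrow>
    (nat \<Rightarrow> nat \<times> 'i) set \<Rightarrow> ennreal" where
  "pullback_fun I D rt \<omega> A =
     (\<integral>\<^sup>+x. ennreal (real (fibre_card_on I D rt A x) / real (fibre_card I D rt x)) \<partial>\<omega>)"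

definition pullback ::
  "(nat \<Rightarrow> 'i set) \<Rightarrow> (nat \<Rightarrow> 'i \<Rightarrow> 'a::metric_space set) \<Rightarrow> 'i \<Rightarrow> 'a measure \<Rightarrow>
    (nat \<Rightarrow> nat \<times> 'i) measure" where
  "pullback I D rt \<omega> =
     measure_of (tree_boundary I D rt) (sets (boundary_borel I D rt)) (pullback_fun I D rt \<omega>)"

definition supp :: "'b topology \<Rightarrow> 'b measure \<Rightarrow> 'b set" where
  "supp \<tau> \<mu> = {x \<in> topspace \<tau>. \<forall>U. openin \<tau> U \<longrightarrow> x \<in> U \<longrightarrow> 0 < emeasure \<mu> U}"

end

theory Submission
  imports Defs
begin

text \<open>Ahlfors regularity bounds the number of cubes of a given small size near a point. Since the
  cubes of each level are dense, every point in the closure of a cube therefore lies in the closure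
  of one of its children, so rays through a cube realise every point of its closure, and the fibres
  of \<open>\<Lambda>\<close> are nonempty with bounded cardinality. Neither \<open>X\<close> nor the tree need be separable:
  \<open>N\<^sub>U\<close> is first handled for an arbitrary open \<open>U\<close>, where \<open>{N\<^sub>U \<ge> n}\<close> is an \<open>F\<^sub>\<sigma>\<close> set, and
  Dynkin's theorem then gives all Borel sets. For (iv), a point whose finitely many preimages all
  have null cylinders has a neighbourhood whose preimage is covered by these cylinders. Finally (v)
  and (iii) follow from (i) and (iv).\<close>

locale regular_dyadic_system =
  ahlfors_regular m Q c1 c2 + dyadic_system m I D z rt \<delta> a0 c4
  for m :: "'a::complete_space measure" and Q c1 c2 :: real
    and I :: "nat \<Rightarrow> 'i set" and D :: "nat \<Rightarrow> 'i \<Rightarrow> 'a set"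
    and z :: "nat \<Rightarrow> 'i \<Rightarrow> 'a" and rt :: 'i and \<delta> a0 c4 :: real
begin

abbreviation "rays \<equiv> tree_boundary I D rt"
abbreviation "fibre x \<equiv> {\<xi> \<in> rays. Lam D \<xi> = x}"
abbreviation "count_on \<equiv> fibre_card_on I D rt"

section \<open>Cubes\<close>

lemma cube_ne: "\<alpha> \<in> I k \<Longrightarrow> D k \<alpha> \<noteq> {}"
  using centre by blast

lemma cube_eqI: "\<lbrakk>\<alpha> \<in> I k; \<beta> \<in> I k; D k \<alpha> \<inter> D k \<beta> \<noteq> {}\<rbrakk> \<Longrightarrow> \<alpha> = \<beta>"
  using disjoint[of k] unfolding disjoint_family_on_def by blast

lemma nestedI:
  "\<lbrakk>k \<le> l; \<alpha> \<in> I k; \<beta> \<in> I l; D l \<beta> \<inter> D k \<alpha> \<noteq> {}\<rbrakk> \<Longrightarrow> D l \<beta> \<subseteq> D k \<alpha>"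
  using nested by blast

lemma ancestor_ex:
  assumes "k \<le> l" "\<beta> \<in> I l"
  shows "\<exists>\<alpha>\<in>I k. D l \<beta> \<subseteq> D k \<alpha>"
proof (cases "k = l")
  case False
  then show ?thesis using assms unique_ancestor[of k l \<beta>] by (metis le_neq_implies_less)
qed (use assms in auto)

lemma dist_cube:
  assumes "\<alpha> \<in> I k" "x \<in> closure (D k \<alpha>)" "y \<in> closure (D k \<alpha>)"
  shows "dist x y \<le> c4 * \<delta> ^ k"
proof -
  have b: "bounded (D k \<alpha>)"
    using bounded_space bounded_subset by blast
  have "dist x y \<le> diameter (closure (D k \<alpha>))"
    using assms b by (intro diameter_bounded_bound) auto
  also have "\<dots> = diameter (D k \<alpha>)"
    using b by (rule diameter_closure)
  finally show ?thesis
    using diameter_cube[OF assms(1)] by linarith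
qed

lemma delta_pow_small: "0 < e \<Longrightarrow> 0 \<le> c \<Longrightarrow> \<exists>n. \<forall>k\<ge>n. c * \<delta> ^ k < e"
proof -
  assume e: "0 < e" "0 \<le> c"
  have "(\<lambda>k. c * \<delta> ^ k) \<longlonglongrightarrow> c * 0"
    using delta by (intro tendsto_intros LIMSEQ_realpow_zero) auto
  then show ?thesis
    using order_tendstoD(2)[of _ 0 sequentially e] e
    by (simp add: eventually_sequentially)
qed

section \<open>Local finiteness of cubes at small scales\<close>

lemma space_m: "space m = UNIV"
  using sets_eq_imp_space_eq[OF borel_m] by simp

text \<open>Regularity only controls radii up to the diameter; at these levels both
  \<open>a0 * \<delta> ^ k\<close> and \<open>3 * c4 * \<delta> ^ k\<close> are admissible. Writing
  \<open>space m\<close> ties the type of points to the parameter \<open>m\<close>.\<close>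

definition fine_level :: "nat \<Rightarrow> bool" where
  "fine_level k \<longleftrightarrow> (a0 + 3 * c4) * \<delta> ^ k \<le> diameter (space m)"

lemma fine_eventually: "eventually fine_level sequentially"
  using delta_pow_small[OF diameter_pos, of "a0 + 3 * c4"] a0_pos c4_pos
  unfolding fine_level_def space_m eventually_sequentially by (auto intro: less_imp_le)

lemma fine_ex: "\<exists>l\<ge>k. fine_level l"
  using fine_eventually unfolding eventually_sequentially by (meson nle_le)

text \<open>The radius is positive, so every level \<open>k\<close> cube with \<open>x\<close> in
  its closure is captured; it equals the diameter bound, so all captured cubes stay within
  \<open>3 * c4 * \<delta> ^ k\<close> of \<open>x\<close>.\<close>

definition near :: "nat \<Rightarrow> 'a \<Rightarrow> 'i set" where
  "near k x = {\<alpha> \<in> I k. D k \<alpha> \<inter> ball x (c4 * \<delta> ^ k) \<noteq> {}}"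

lemma nearI:
  assumes "\<alpha> \<in> I k" "y \<in> closure (D k \<alpha>)" "dist x y < c4 * \<delta> ^ k"
  shows "\<alpha> \<in> near k x"
  using assms open_Int_closure_eq_empty[OF open_ball, of x "c4 * \<delta> ^ k" "D k \<alpha>"]
  unfolding near_def by auto

lemma near_self: "\<alpha> \<in> I k \<Longrightarrow> x \<in> closure (D k \<alpha>) \<Longrightarrow> \<alpha> \<in> near k x"
  using c4_pos delta by (auto intro: nearI)

text \<open>Ratio of the upper regularity bound at radius \<open>3 * c4 * \<delta> ^ k\<close> to
  the lower bound at radius \<open>a0 * \<delta> ^ k\<close>, rounded up. The scale cancels, so one
  number serves all points and all fine levels.\<close>

definition max_near :: nat where
  "max_near = nat \<lceil>c2 * (3 * c4) powr Q / (c1 * a0 powr Q)\<rceil>"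

text \<open>The cubes near \<open>x\<close> contain disjoint balls of comparable radius inside one ball around \<open>x\<close>.\<close>

lemma card_near_le:
  assumes "fine_level k" "S \<subseteq> near k x" "finite S"
  shows "card S \<le> max_near"
proof -
  let ?d = "diameter (UNIV :: 'a set)"
  have dk: "0 < \<delta> ^ k" using delta by simp
  have pos: "0 < a0 * \<delta> ^ k" "0 < c4 * \<delta> ^ k" using dk a0_pos c4_pos by auto
  have small: "a0 * \<delta> ^ k \<le> ?d" "3 * c4 * \<delta> ^ k \<le> ?d"
    using assms(1) pos unfolding fine_level_def space_m by (simp_all add: algebra_simps)
  have SI: "S \<subseteq> I k" using assms(2) by (auto simp: near_def)
  have sub: "D k \<alpha> \<subseteq> ball x (3 * c4 * \<delta> ^ k)" if "\<alpha> \<in> S" for \<alpha>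
  proof
    fix y assume y: "y \<in> D k \<alpha>"
    have "\<alpha> \<in> near k x" using that assms(2) by blast
    then obtain w where w: "w \<in> D k \<alpha>" "dist x w < c4 * \<delta> ^ k"
      unfolding near_def by auto
    have "dist w y \<le> c4 * \<delta> ^ k"
      using w y that SI closure_subset by (intro dist_cube[of \<alpha>]) blast+
    then show "y \<in> ball x (3 * c4 * \<delta> ^ k)"
      using w(2) pos dist_triangle[of x y w] by (simp add: mult.assoc)
  qed
  have meas: "D k \<alpha> \<in> sets m" if "\<alpha> \<in> I k" for \<alpha>
    using open_cube[OF that] borel_m by simp
  have "of_nat (card S) * ennreal (c1 * (a0 * \<delta> ^ k) powr Q)
      = (\<Sum>\<alpha>\<in>S. ennreal (c1 * (a0 * \<delta> ^ k) powr Q))"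
    by simp
  also have "\<dots> \<le> (\<Sum>\<alpha>\<in>S. emeasure m (D k \<alpha>))"
  proof (rule sum_mono)
    fix \<alpha> assume "\<alpha> \<in> S"
    then have "\<alpha> \<in> I k" using SI by auto
    then show "ennreal (c1 * (a0 * \<delta> ^ k) powr Q) \<le> emeasure m (D k \<alpha>)"
      using regular_lower[of "a0 * \<delta> ^ k" "z k \<alpha>"] small pos
        emeasure_mono[OF ball_in_cube meas] by (meson less_imp_le order_trans)
  qed
  also have "\<dots> = emeasure m (\<Union>\<alpha>\<in>S. D k \<alpha>)"
    using SI meas assms(3) disjoint_family_on_mono[OF SI disjoint]
    by (intro sum_emeasure) auto
  also have "\<dots> \<le> emeasure m (ball x (3 * c4 * \<delta> ^ k))"
    using sub by (intro emeasure_mono) (auto simp: borel_m)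
  also have "\<dots> \<le> ennreal (c2 * (3 * c4 * \<delta> ^ k) powr Q)"
    using small pos by (intro regular_upper) (auto simp: mult.assoc)
  finally have "ennreal (real (card S) * (c1 * (a0 * \<delta> ^ k) powr Q))
      \<le> ennreal (c2 * (3 * c4 * \<delta> ^ k) powr Q)"
    using c1_pos by (simp add: ennreal_mult ennreal_of_nat_eq_real_of_nat)
  then have "real (card S) * (c1 * (a0 * \<delta> ^ k) powr Q) \<le> c2 * (3 * c4 * \<delta> ^ k) powr Q"
    using c1_pos c1_less_c2 by (subst (asm) ennreal_le_iff) auto
  then have "(real (card S) * (c1 * a0 powr Q)) * (\<delta> ^ k) powr Q
      \<le> (c2 * (3 * c4) powr Q) * (\<delta> ^ k) powr Q"
    using a0_pos c4_pos dk by (simp add: powr_mult mult.assoc)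
  then have "real (card S) * (c1 * a0 powr Q) \<le> c2 * (3 * c4) powr Q"
    by (rule mult_right_le_imp_le) (use delta in simp)
  then have "real (card S) \<le> c2 * (3 * c4) powr Q / (c1 * a0 powr Q)"
    using c1_pos a0_pos by (simp add: pos_le_divide_eq)
  then show ?thesis
    unfolding max_near_def by linarith
qed

lemma finite_near: "fine_level k \<Longrightarrow> finite (near k x)"
  using card_near_le by (intro finite_if_finite_subsets_card_bdd[THEN conjunct1]) blast

section \<open>Density and refinement of cubes\<close>

lemma open_meets_cube:
  assumes "open W" "W \<noteq> {}"
  shows "\<exists>\<beta>\<in>I k. D k \<beta> \<inter> W \<noteq> {}"
proof (rule ccontr)
  assume neg: "\<not> ?thesis"
  let ?d = "diameter (UNIV :: 'a set)"
  obtain x e where e: "0 < e" "ball x e \<subseteq> W"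
    using assms by (metis open_contains_ball ex_in_conv)
  define r where "r = min e ?d"
  have r: "0 < r" "r \<le> ?d" "ball x r \<subseteq> W"
    using e diameter_pos by (auto simp: r_def)
  \<comment> \<open>What the level \<open>k\<close> cubes miss is closed and null, whereas a ball of
    positive radius has positive measure.\<close>
  have "open (\<Union>\<alpha>\<in>I k. D k \<alpha>)" using open_cube by blast
  then have "UNIV - (\<Union>\<alpha>\<in>I k. D k \<alpha>) \<in> sets m"
    unfolding borel_m by (intro borel_closed) (auto simp: closed_def Compl_eq_Diff_UNIV[symmetric])
  moreover have "ball x r \<subseteq> UNIV - (\<Union>\<alpha>\<in>I k. D k \<alpha>)"
    using neg r by blast
  ultimately have "emeasure m (ball x r) \<le> 0"
    using emeasure_mono full_measure by metis
  moreover have "0 < c1 * r powr Q" using c1_pos r by simp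
  ultimately show False
    using regular_lower[of r x] r by (simp add: ennreal_eq_0_iff)
qed

text \<open>Otherwise deleting the closures of the finitely many subcubes near \<open>x\<close>
  leaves an open neighbourhood of \<open>x\<close>. It meets \<open>D k \<alpha>\<close>, so by
  density some level \<open>l\<close> cube meets the intersection; by nesting, that cube is one
  whose closure was deleted.\<close>

lemma refine_fine:
  assumes "\<alpha> \<in> I k" "x \<in> closure (D k \<alpha>)" "k \<le> l" "fine_level l"
  shows "\<exists>\<beta>\<in>I l. D l \<beta> \<subseteq> D k \<alpha> \<and> x \<in> closure (D l \<beta>)"
proof (rule ccontr)
  assume neg: "\<not> ?thesis"
  define F where "F = {\<beta> \<in> near l x. D l \<beta> \<subseteq> D k \<alpha>}"
  have F: "finite F" using finite_near[OF assms(4)] by (simp add: F_def)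
  define W where "W = ball x (c4 * \<delta> ^ l) - (\<Union>\<beta>\<in>F. closure (D l \<beta>))"
  have "open W" unfolding W_def using F by (intro open_Diff closed_UN) auto
  moreover have "x \<in> W"
    using neg c4_pos delta by (auto simp: W_def F_def near_def)
  ultimately have "W \<inter> D k \<alpha> \<noteq> {}"
    using assms(2) open_Int_closure_eq_empty by blast
  then obtain \<beta> where b: "\<beta> \<in> I l" "D l \<beta> \<inter> (W \<inter> D k \<alpha>) \<noteq> {}"
    using open_meets_cube[of "W \<inter> D k \<alpha>" l] \<open>open W\<close> open_cube[OF assms(1)] by blast
  then have "D l \<beta> \<subseteq> D k \<alpha>" using nestedI[OF assms(3,1)] by blast
  then have "\<beta> \<in> F" using b by (auto simp: F_def near_def W_def)
  then show False using b closure_subset by (fastforce simp: W_def)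
qed

lemma refine:
  assumes "\<alpha> \<in> I k" "x \<in> closure (D k \<alpha>)" "k \<le> l"
  shows "\<exists>\<beta>\<in>I l. D l \<beta> \<subseteq> D k \<alpha> \<and> x \<in> closure (D l \<beta>)"
proof -
  \<comment> \<open>Level \<open>l\<close> may be too coarse for local finiteness: refine down to a
    fine level \<open>j\<close>, then climb to the ancestor at level \<open>l\<close>.\<close>
  obtain j where j: "l \<le> j" "fine_level j" using fine_ex by blast
  then obtain \<gamma> where g: "\<gamma> \<in> I j" "D j \<gamma> \<subseteq> D k \<alpha>" "x \<in> closure (D j \<gamma>)"
    using refine_fine[OF assms(1,2)] assms(3) by (meson order_trans)
  obtain \<beta> where b: "\<beta> \<in> I l" "D j \<gamma> \<subseteq> D l \<beta>" using ancestor_ex[OF j(1) g(1)] by blast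
  then have "D l \<beta> \<subseteq> D k \<alpha>"
    using nestedI[OF assms(3,1) b(1)] g cube_ne[OF g(1)] by blast
  then show ?thesis using b g closure_mono by blast
qed

text \<open>Only finitely many level \<open>k\<close> cubes have closures reaching the ball around
  \<open>x\<close>, so the closures missing \<open>x\<close> can be removed from it. This
  semicontinuity underlies both the Borel property of the counts and the support formula.\<close>

lemma closure_locally:
  assumes "fine_level k"
  shows "\<exists>W. open W \<and> x \<in> W \<and>
    (\<forall>y\<in>W. \<forall>\<alpha>\<in>I k. y \<in> closure (D k \<alpha>) \<longrightarrow> x \<in> closure (D k \<alpha>))"
proof -
  define F where "F = {\<beta> \<in> near k x. x \<notin> closure (D k \<beta>)}"
  have F: "finite F" using finite_near[OF assms] by (simp add: F_def)
  define W where "W = ball x (c4 * \<delta> ^ k) - (\<Union>\<beta>\<in>F. closure (D k \<beta>))"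
  have "open W" unfolding W_def using F by (intro open_Diff closed_UN) auto
  moreover have "x \<in> W" using c4_pos delta by (auto simp: W_def F_def)
  moreover have "x \<in> closure (D k \<alpha>)"
    if "y \<in> W" "\<alpha> \<in> I k" "y \<in> closure (D k \<alpha>)" for y \<alpha>
    using that nearI[of \<alpha> k y x] by (auto simp: W_def F_def)
  ultimately show ?thesis by blast
qed

section \<open>Rays and the boundary map\<close>

text \<open>Each edge changes the level by exactly one, so no walk gets from level \<open>i\<close>
  to level \<open>j\<close> in fewer than \<open>j - i\<close> steps.\<close>

lemma graph_dist_levels:
  assumes step: "\<And>n. (\<xi> n, \<xi> (Suc n)) \<in> tree_edges I D"
    and level: "\<And>n. fst (\<xi> n) = n" and "i \<le> j"
  shows "graph_dist (tree_edges I D) (\<xi> i) (\<xi> j) = j - i"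
proof -
  have path: "(\<xi> i, \<xi> (i + n)) \<in> tree_edges I D ^^ n" for n
    by (induction n) (use step in \<open>auto intro: relcompI\<close>)
  have lower: "fst w \<le> fst v + n" if "(v, w) \<in> tree_edges I D ^^ n" for v w n
    using that
  proof (induction n arbitrary: w)
    case (Suc n)
    then obtain u where "(v, u) \<in> tree_edges I D ^^ n" "(u, w) \<in> tree_edges I D" by auto
    then show ?case
      using Suc.IH[of u] by (auto simp: tree_edges_def child_of_def)
  qed simp
  show ?thesis
    unfolding graph_dist_def
  proof (rule Least_equality)
    show "(\<xi> i, \<xi> j) \<in> tree_edges I D ^^ (j - i)"
      using path[of "j - i"] assms(3) by simp
    show "j - i \<le> n" if "(\<xi> i, \<xi> j) \<in> tree_edges I D ^^ n" for n
      using lower[OF that] by (simp add: level)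
  qed
qed

text \<open>Eliminates the graph metric: the levels orient every edge of a ray downwards, and
  conversely make any descending chain geodesic. The root condition comes from
  \<open>level_0\<close>.\<close>

lemma rays_iff:
  "\<xi> \<in> rays \<longleftrightarrow> (\<forall>n. fst (\<xi> n) = n \<and> snd (\<xi> n) \<in> I n \<and>
     D (Suc n) (snd (\<xi> (Suc n))) \<subseteq> D n (snd (\<xi> n)))"
  (is "_ \<longleftrightarrow> ?R")
proof
  assume "\<xi> \<in> rays"
  then have step: "(\<xi> n, \<xi> (Suc n)) \<in> tree_edges I D" and level: "fst (\<xi> n) = n" for n
    unfolding tree_boundary_def geodesic_ray_def by auto
  show ?R
  proof
    fix n
    show "fst (\<xi> n) = n \<and> snd (\<xi> n) \<in> I n \<and> D (Suc n) (snd (\<xi> (Suc n))) \<subseteq> D n (snd (\<xi> n))"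
      using step[of n] level[of n] level[of "Suc n"]
      by (auto simp: tree_edges_def child_of_def tree_vertices_def)
  qed
next
  assume R: ?R
  have step: "(\<xi> n, \<xi> (Suc n)) \<in> tree_edges I D" for n
  proof -
    have "\<xi> k \<in> tree_vertices I" for k
      using R[rule_format, of k] by (cases "\<xi> k") (simp add: tree_vertices_def)
    then show ?thesis using R by (simp add: tree_edges_def child_of_def)
  qed
  have "snd (\<xi> 0) \<in> I 0" using R by blast
  then have "\<xi> 0 = (0, rt)" using R level_0 by (metis prod.collapse singletonD)
  then show "\<xi> \<in> rays"
    using R step graph_dist_levels[of \<xi>] unfolding tree_boundary_def geodesic_ray_def by auto
qed

lemma ray_level: "\<xi> \<in> rays \<Longrightarrow> fst (\<xi> n) = n"
  and ray_index: "\<xi> \<in> rays \<Longrightarrow> snd (\<xi> n) \<in> I n"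
  by (auto simp: rays_iff)

lemma ray_decreasing: "\<xi> \<in> rays \<Longrightarrow> j \<le> k \<Longrightarrow> D k (snd (\<xi> k)) \<subseteq> D j (snd (\<xi> j))"
  by (rule lift_Suc_antimono_le[of "\<lambda>n. D n (snd (\<xi> n))"]) (auto simp: rays_iff)

text \<open>Both level \<open>j\<close> cubes contain the nonempty common cube of level
  \<open>k\<close>, and cubes of one level are disjoint.\<close>

lemma ray_eq_below:
  assumes "\<xi> \<in> rays" "\<eta> \<in> rays" "\<xi> k = \<eta> k" "j \<le> k"
  shows "\<xi> j = \<eta> j"
proof (rule prod_eqI)
  show "fst (\<xi> j) = fst (\<eta> j)" using assms by (simp add: ray_level)
  show "snd (\<xi> j) = snd (\<eta> j)"
    using ray_decreasing[OF assms(1,4)] ray_decreasing[OF assms(2,4)] assms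
      cube_ne[OF ray_index[OF assms(1)], of k] ray_index
    by (intro cube_eqI) auto
qed

text \<open>Rays that have parted never meet again, and there are only finitely many pairs to
  separate.\<close>

lemma rays_separate:
  assumes "finite G" "G \<subseteq> rays"
  shows "eventually (\<lambda>k. inj_on (\<lambda>\<xi>. \<xi> k) G) sequentially"
proof -
  have "eventually (\<lambda>k. \<xi> k = \<eta> k \<longrightarrow> \<xi> = \<eta>) sequentially" if "\<xi> \<in> G" "\<eta> \<in> G" for \<xi> \<eta>
  proof (cases "\<xi> = \<eta>")
    case False
    then obtain n where "\<xi> n \<noteq> \<eta> n" by auto
    then show ?thesis
      using ray_eq_below[of \<xi> \<eta>] that assms unfolding eventually_sequentially by blast
  qed simp
  then show ?thesis
    unfolding inj_on_def using assms(1) by (intro eventually_ball_finite ballI) auto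
qed

section \<open>The limit point of a ray\<close>

lemma ray_limit_ex:
  assumes "\<xi> \<in> rays"
  shows "\<exists>x. \<forall>n. x \<in> closure (D n (snd (\<xi> n)))"
proof -
  \<comment> \<open>From level \<open>k\<close> on, the distinguished points stay in the level
    \<open>k\<close> cube of the ray; the diameters tend to zero, so completeness supplies a
    limit.\<close>
  define x where "x n = z n (snd (\<xi> n))" for n
  have x: "x n \<in> D k (snd (\<xi> k))" if "k \<le> n" for k n
    using centre[OF ray_index[OF assms]] ray_decreasing[OF assms that] by (auto simp: x_def)
  have "Cauchy x"
  proof (rule metric_CauchyI)
    fix e :: real assume "0 < e"
    then obtain n where n: "c4 * \<delta> ^ n < e" using delta_pow_small[of e c4] c4_pos by auto
    have "dist (x i) (x j) < e" if "n \<le> i" "n \<le> j" for i j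
      using dist_cube[OF ray_index[OF assms], of "x i" n "x j"] x[OF that(1)] x[OF that(2)] n
        closure_subset by fastforce
    then show "\<exists>n. \<forall>i\<ge>n. \<forall>j\<ge>n. dist (x i) (x j) < e" by blast
  qed
  then obtain y where y: "x \<longlonglongrightarrow> y" using Cauchy_convergent convergent_def by blast
  have "y \<in> closure (D k (snd (\<xi> k)))" for k
  proof (rule Lim_in_closed_set[OF closed_closure _ _ y])
    show "\<forall>\<^sub>F n in sequentially. x n \<in> closure (D k (snd (\<xi> k)))"
      using x closure_subset unfolding eventually_sequentially by blast
  qed simp
  then show ?thesis by blast
qed

lemma ray_limit_unique:
  assumes "\<xi> \<in> rays" "\<And>n. x \<in> closure (D n (snd (\<xi> n)))" "\<And>n. y \<in> closure (D n (snd (\<xi> n)))"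
  shows "x = y"
proof (rule ccontr)
  assume "x \<noteq> y"
  then obtain n where n: "c4 * \<delta> ^ n < dist x y"
    using delta_pow_small[of "dist x y" c4] c4_pos by auto
  then show False using dist_cube[OF ray_index[OF assms(1)] assms(2,3)] by (meson not_less)
qed

lemma Lam_in: "\<xi> \<in> rays \<Longrightarrow> Lam D \<xi> \<in> closure (D n (snd (\<xi> n)))"
  and Lam_eqI: "\<xi> \<in> rays \<Longrightarrow> (\<And>n. x \<in> closure (D n (snd (\<xi> n)))) \<Longrightarrow> Lam D \<xi> = x"
proof -
  have key: "Lam D \<xi> = x" if \<xi>: "\<xi> \<in> rays" and x: "\<And>n. x \<in> closure (D n (snd (\<xi> n)))" for \<xi> x
    unfolding Lam_def using x ray_limit_unique[OF \<xi>]
    by (intro the_equality) (auto simp: ray_level[OF \<xi>])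
  then show "\<xi> \<in> rays \<Longrightarrow> (\<And>n. x \<in> closure (D n (snd (\<xi> n)))) \<Longrightarrow> Lam D \<xi> = x" .
  show "\<xi> \<in> rays \<Longrightarrow> Lam D \<xi> \<in> closure (D n (snd (\<xi> n)))"
    using key ray_limit_ex by metis
qed

text \<open>From a descending chain of cubes starting at \<open>\<alpha>\<close>, the ray is read off by taking the
  ancestor at level \<open>n\<close> of the cube at level \<open>k + n\<close>.\<close>

lemma ray_through:
  assumes "\<alpha> \<in> I k" "x \<in> closure (D k \<alpha>)"
  obtains \<xi> where "\<xi> \<in> rays" "\<xi> k = (k, \<alpha>)" "Lam D \<xi> = x"
proof -
  define P where "P n \<beta> \<longleftrightarrow> \<beta> \<in> I (k + n) \<and> D (k + n) \<beta> \<subseteq> D k \<alpha> \<and> x \<in> closure (D (k + n) \<beta>)" for n \<beta>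
  have "P 0 \<alpha>" using assms by (simp add: P_def)
  moreover have "\<exists>\<gamma>. P (Suc n) \<gamma> \<and> D (k + Suc n) \<gamma> \<subseteq> D (k + n) \<beta>" if "P n \<beta>" for n \<beta>
    using that refine[of \<beta> "k + n" x "k + Suc n"] unfolding P_def by fastforce
  ultimately obtain g where "\<And>n. P n (g n)"
    and step: "\<And>n. D (k + Suc n) (g (Suc n)) \<subseteq> D (k + n) (g n)"
    using dependent_nat_choice[of P "\<lambda>n \<beta> \<gamma>. D (k + Suc n) \<gamma> \<subseteq> D (k + n) \<beta>"] by metis
  then have g: "\<And>n. g n \<in> I (k + n)" "\<And>n. D (k + n) (g n) \<subseteq> D k \<alpha>"
    "\<And>n. x \<in> closure (D (k + n) (g n))"
    by (auto simp: P_def)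
  have "\<exists>\<beta>\<in>I n. D (k + n) (g n) \<subseteq> D n \<beta>" for n
    using g by (intro ancestor_ex) auto
  then obtain h where h: "\<And>n. h n \<in> I n" "\<And>n. D (k + n) (g n) \<subseteq> D n (h n)"
    by metis
  let ?\<xi> = "\<lambda>n. (n, h n)"
  have "D (Suc n) (h (Suc n)) \<subseteq> D n (h n)" for n
  proof (rule nestedI[OF le_SucI[OF order_refl] h(1) h(1)])
    have "D (k + Suc n) (g (Suc n)) \<subseteq> D (Suc n) (h (Suc n)) \<inter> D n (h n)"
      using h(2)[of "Suc n"] h(2)[of n] step[of n] by simp
    then show "D (Suc n) (h (Suc n)) \<inter> D n (h n) \<noteq> {}"
      using cube_ne[OF g(1)[of "Suc n"]] by auto
  qed
  then have ray: "?\<xi> \<in> rays" using h by (simp add: rays_iff)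
  \<comment> \<open>The reindexed ray does pass through \<alpha>: the cube of \<open>g k\<close>
    lies in both cubes of level \<open>k\<close>.\<close>
  have "h k = \<alpha>"
  proof (rule cube_eqI[OF h(1) assms(1)])
    show "D k (h k) \<inter> D k \<alpha> \<noteq> {}"
      using h(2)[of k] g(2)[of k] cube_ne[OF g(1)[of k]] by auto
  qed
  moreover have "Lam D ?\<xi> = x"
    using g(3) closure_mono[OF h(2)] by (intro Lam_eqI[OF ray]) auto
  ultimately show thesis using that[OF ray] by simp
qed

lemma Lam_onto:
  obtains \<xi> where "\<xi> \<in> rays" "Lam D \<xi> = x"
  using ray_through[of rt 0 x] level_0 by auto

text \<open>At a fine level separating the rays of \<open>G\<close>, they give distinct cubes near
  \<open>x\<close>. Finite subsets are bounded first because \<open>card\<close> is zero on infinite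
  sets.\<close>

lemma card_fibre_subset:
  assumes "finite G" "G \<subseteq> fibre x"
  shows "card G \<le> max_near"
proof -
  have "eventually (\<lambda>k. fine_level k \<and> inj_on (\<lambda>\<xi>. \<xi> k) G) sequentially"
    using assms fine_eventually by (intro eventually_conj rays_separate) auto
  then obtain k where k: "fine_level k" "inj_on (\<lambda>\<xi>. \<xi> k) G"
    using eventually_happens by force
  have "inj_on (\<lambda>\<xi>. snd (\<xi> k)) G"
    using k(2) assms(2) ray_level unfolding inj_on_def by (metis (mono_tags, lifting) mem_Collect_eq prod_eqI subsetD)
  moreover have "(\<lambda>\<xi>. snd (\<xi> k)) ` G \<subseteq> near k x"
    using assms(2) ray_index Lam_in by (auto intro!: near_self)
  ultimately show ?thesis
    using card_near_le[OF k(1)] assms(1) by (metis card_image finite_imageI)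
qed

lemma finite_fibre: "finite (fibre x)" and card_fibre_le: "card (fibre x) \<le> max_near"
  using finite_if_finite_subsets_card_bdd[of "fibre x" max_near] card_fibre_subset by blast+

section \<open>The boundary topology\<close>

lemma cylinder_eq:
  "\<alpha> \<in> I k \<Longrightarrow> cylinder I D rt (k, \<alpha>) = {\<xi> \<in> rays. \<xi> k = (k, \<alpha>)}"
  unfolding cylinder_def using ray_level by (metis fst_conv rangeE rangeI)

lemma openin_cylinder: "\<xi> \<in> rays \<Longrightarrow> openin (boundary_topology I D rt) {\<eta> \<in> rays. \<eta> k = \<xi> k}"
proof -
  assume "\<xi> \<in> rays"
  then obtain \<alpha> where a: "\<xi> k = (k, \<alpha>)" "\<alpha> \<in> I k"
    using ray_level[of \<xi> k] ray_index[of \<xi> k] by (cases "\<xi> k") auto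
  have "{\<eta> \<in> rays. \<eta> k = \<xi> k} = cylinder I D rt (k, \<alpha>)"
    using a by (simp add: cylinder_eq)
  moreover have "(k, \<alpha>) \<in> tree_vertices I" using a by (simp add: tree_vertices_def)
  ultimately have "{\<eta> \<in> rays. \<eta> k = \<xi> k} \<in> cylinder I D rt ` tree_vertices I"
    by (rule image_eqI)
  then show ?thesis
    unfolding boundary_topology_def openin_topology_generated_by_iff
    by (rule generate_topology_on.Basis)
qed

text \<open>The cylinders along \<xi> decrease and form a neighbourhood base. The form "for all
  large levels" lets finitely many requirements be met at a common level.\<close>

lemma openin_imp_eventually:
  assumes "openin (boundary_topology I D rt) U" "\<xi> \<in> U"
  shows "eventually (\<lambda>k. \<forall>\<eta>\<in>rays. \<eta> k = \<xi> k \<longrightarrow> \<eta> \<in> U) sequentially"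
proof -
  have "generate_topology_on (cylinder I D rt ` tree_vertices I) U"
    using assms(1) unfolding boundary_topology_def openin_topology_generated_by_iff .
  then show ?thesis
    using assms(2)
  proof (induction)
    case (Int U V)
    then show ?case by (auto elim: eventually_elim2)
  next
    case (UN \<U>)
    then obtain U where "U \<in> \<U>" "\<xi> \<in> U" by blast
    then show ?case by (intro eventually_mono[OF UN.IH]) auto
  next
    case (Basis U)
    then obtain j \<alpha> where a: "\<alpha> \<in> I j" "U = {\<eta> \<in> rays. \<eta> j = (j, \<alpha>)}"
      by (auto simp: tree_vertices_def cylinder_eq)
    have "\<forall>\<eta>\<in>rays. \<eta> k = \<xi> k \<longrightarrow> \<eta> \<in> U" if "j \<le> k" for k
      using Basis.prems ray_eq_below[of _ \<xi> k j] that a by auto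
    then show ?case unfolding eventually_sequentially by blast
  qed simp
qed

lemma openin_boundaryI:
  assumes "U \<subseteq> rays" "\<And>\<xi>. \<xi> \<in> U \<Longrightarrow> \<exists>k. \<forall>\<eta>\<in>rays. \<eta> k = \<xi> k \<longrightarrow> \<eta> \<in> U"
  shows "openin (boundary_topology I D rt) U"
proof (subst openin_subopen, intro ballI)
  fix \<xi> assume "\<xi> \<in> U"
  then obtain k where "\<forall>\<eta>\<in>rays. \<eta> k = \<xi> k \<longrightarrow> \<eta> \<in> U" using assms(2) by blast
  then show "\<exists>T. openin (boundary_topology I D rt) T \<and> \<xi> \<in> T \<and> T \<subseteq> U"
    using openin_cylinder[of \<xi> k] assms(1) \<open>\<xi> \<in> U\<close>
    by (intro exI[of _ "{\<eta> \<in> rays. \<eta> k = \<xi> k}"]) auto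
qed

text \<open>Continuity of \<open>Lam D\<close>: rays agreeing at level \<open>k\<close> have images
  in the closure of one cube, hence at distance at most \<open>c4 * \<delta> ^ k\<close>.\<close>

lemma openin_Lam_vimage:
  assumes "open W"
  shows "openin (boundary_topology I D rt) (Lam D -` W \<inter> rays)"
proof (rule openin_boundaryI)
  fix \<xi> assume \<xi>: "\<xi> \<in> Lam D -` W \<inter> rays"
  then obtain e where e: "0 < e" "ball (Lam D \<xi>) e \<subseteq> W" using assms by (auto simp: open_contains_ball)
  obtain k where k: "c4 * \<delta> ^ k < e" using delta_pow_small[OF e(1), of c4] c4_pos by auto
  have "Lam D \<eta> \<in> W" if "\<eta> \<in> rays" "\<eta> k = \<xi> k" for \<eta>
  proof -
    have "dist (Lam D \<xi>) (Lam D \<eta>) \<le> c4 * \<delta> ^ k"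
      using \<xi> that Lam_in[of \<eta> k] by (intro dist_cube[OF ray_index[of \<xi>]] Lam_in) auto
    then show ?thesis using e k by auto
  qed
  then show "\<exists>k. \<forall>\<eta>\<in>rays. \<eta> k = \<xi> k \<longrightarrow> \<eta> \<in> Lam D -` W \<inter> rays" by auto
qed simp

lemma openin_subset_rays: "openin (boundary_topology I D rt) U \<Longrightarrow> U \<subseteq> rays"
  by (metis openin_subset topspace_boundary_topology)

lemma opens_Pow: "{U. openin (boundary_topology I D rt) U} \<subseteq> Pow rays"
  using openin_subset_rays by auto

lemma sets_boundary_borel:
  "sets (boundary_borel I D rt) = sigma_sets rays {U. openin (boundary_topology I D rt) U}"
  unfolding boundary_borel_def by (rule sets_measure_of[OF opens_Pow])

lemma space_boundary_borel: "space (boundary_borel I D rt) = rays"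
  unfolding boundary_borel_def by (rule space_measure_of[OF opens_Pow])

lemma openin_in_sets: "openin (boundary_topology I D rt) U \<Longrightarrow> U \<in> sets (boundary_borel I D rt)"
  unfolding sets_boundary_borel by (auto intro: sigma_sets.Basic)

lemma measurable_Lam:
  assumes "sets \<nu> = sets (boundary_borel I D rt)"
  shows "Lam D \<in> borel_measurable \<nu>"
proof (rule borel_measurableI)
  fix W :: "'a set" assume "open W"
  then show "Lam D -` W \<inter> space \<nu> \<in> sets \<nu>"
    using openin_in_sets openin_Lam_vimage assms sets_eq_imp_space_eq[OF assms]
    by (simp add: space_boundary_borel)
qed

section \<open>The counting functions are Borel\<close>

lemma count_on_def': "count_on A x = card (fibre x \<inter> A)"
  unfolding fibre_card_on_def by (rule arg_cong[where f = card]) auto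

lemma count_on_eq_sum: "real (count_on A x) = (\<Sum>\<xi>\<in>fibre x. indicator A \<xi>)"
  unfolding count_on_def' using sum.inter_restrict[where g = "\<lambda>_. 1::real" and B = A, OF finite_fibre]
  by (simp add: indicator_def of_bool_def)

lemma count_on_sums:
  assumes "disjoint_family A"
  shows "(\<lambda>i. real (count_on (A i) x)) sums real (count_on (\<Union>i. A i) x)"
  unfolding count_on_eq_sum
  using assms by (intro sums_sum indicator_sums) (auto simp: disjoint_family_on_def)

text \<open>By \<open>closure_locally\<close>, moving slightly away from \<open>x\<close> brings in
  no new cube, so the strict sublevel sets of the count are open.\<close>

lemma closed_card_cubes:
  assumes "fine_level k" "S \<subseteq> I k"
  shows "closed {x. n \<le> card {\<alpha> \<in> S. x \<in> closure (D k \<alpha>)}}"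
proof -
  let ?c = "\<lambda>x. card {\<alpha> \<in> S. x \<in> closure (D k \<alpha>)}"
  have "\<exists>W. open W \<and> x \<in> W \<and> W \<subseteq> {x. ?c x < n}" if "?c x < n" for x
  proof -
    obtain W where W: "open W" "x \<in> W"
      "\<forall>y\<in>W. \<forall>\<alpha>\<in>I k. y \<in> closure (D k \<alpha>) \<longrightarrow> x \<in> closure (D k \<alpha>)"
      using closure_locally[OF assms(1)] by blast
    have "finite {\<alpha> \<in> S. x \<in> closure (D k \<alpha>)}"
      using assms near_self by (intro finite_subset[OF _ finite_near[OF assms(1), of x]]) auto
    then have "?c y \<le> ?c x" if "y \<in> W" for y
      using W(3) that assms(2) by (intro card_mono) auto
    then show ?thesis using W that by (intro exI[of _ W]) (auto intro: le_less_trans)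
  qed
  then have "open {x. ?c x < n}" by (subst openin_subopen[of euclidean, simplified]) (simp; blast)
  then show ?thesis by (simp add: closed_def Collect_neg_eq[symmetric] not_le)
qed

text \<open>At a fixed level only finitely many cubes come near a point, so the number of cubes whose
  cylinder lies in \<open>U\<close> and whose closure contains \<open>x\<close> is upper semicontinuous in \<open>x\<close>; these
  numbers increase to the number of preimages of \<open>x\<close> in \<open>U\<close>.\<close>

lemma count_on_open_ge:
  assumes U: "openin (boundary_topology I D rt) U"
  shows "n \<le> count_on U x \<longleftrightarrow> (\<exists>k. fine_level k \<and>
    n \<le> card {\<alpha> \<in> {\<alpha> \<in> I k. \<forall>\<xi>\<in>rays. \<xi> k = (k, \<alpha>) \<longrightarrow> \<xi> \<in> U}. x \<in> closure (D k \<alpha>)})"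
  (is "_ \<longleftrightarrow> (\<exists>k. fine_level k \<and> n \<le> card (?C k))")
proof
  assume n: "n \<le> count_on U x"
  let ?G = "fibre x \<inter> U"
  have fin: "finite ?G" using finite_fibre by simp
  \<comment> \<open>At a deep level the preimages in \<open>U\<close> are separated and their
    cylinders lie in \<open>U\<close>, so they become distinct counted cubes.\<close>
  have "eventually (\<lambda>k. fine_level k \<and> inj_on (\<lambda>\<xi>. \<xi> k) ?G \<and>
      (\<forall>\<xi>\<in>?G. \<forall>\<eta>\<in>rays. \<eta> k = \<xi> k \<longrightarrow> \<eta> \<in> U)) sequentially"
    using fin fine_eventually openin_imp_eventually[OF U]
    by (intro eventually_conj rays_separate eventually_ball_finite) auto
  then obtain k where k: "fine_level k" "inj_on (\<lambda>\<xi>. \<xi> k) ?G"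
      "\<forall>\<xi>\<in>?G. \<forall>\<eta>\<in>rays. \<eta> k = \<xi> k \<longrightarrow> \<eta> \<in> U"
    using eventually_happens by force
  have "inj_on (\<lambda>\<xi>. snd (\<xi> k)) ?G"
    using k(2) ray_level unfolding inj_on_def by (auto simp: prod_eq_iff)
  moreover have "(\<lambda>\<xi>. snd (\<xi> k)) ` ?G \<subseteq> ?C k"
    using k(3) ray_index Lam_in ray_level by (auto simp: prod_eq_iff)
  moreover have "finite (?C k)"
    using near_self by (intro finite_subset[OF _ finite_near[OF k(1), of x]]) auto
  ultimately have "card ?G \<le> card (?C k)" by (rule card_inj_on_le)
  then show "\<exists>k. fine_level k \<and> n \<le> card (?C k)"
    using n k(1) unfolding count_on_def' by (meson order_trans)
next
  assume "\<exists>k. fine_level k \<and> n \<le> card (?C k)"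
  then obtain k where k: "n \<le> card (?C k)" by blast
  \<comment> \<open>Each counted cube carries a ray ending at \<open>x\<close>, which lies in
    \<open>U\<close> because the whole cylinder does; distinct cubes give distinct rays.\<close>
  have "\<exists>\<xi>. \<xi> \<in> fibre x \<inter> U \<and> \<xi> k = (k, \<alpha>)" if "\<alpha> \<in> ?C k" for \<alpha>
    using that ray_through[of \<alpha> k x] by (smt (verit) IntI mem_Collect_eq)
  then have "\<forall>\<alpha>\<in>?C k. \<exists>\<xi>. \<xi> \<in> fibre x \<inter> U \<and> \<xi> k = (k, \<alpha>)" by (rule ballI)
  from bchoice[OF this] obtain f
    where f: "\<forall>\<alpha>\<in>?C k. f \<alpha> \<in> fibre x \<inter> U \<and> f \<alpha> k = (k, \<alpha>)" ..
  have "inj_on f (?C k)" using f by (intro inj_on_inverseI[of _ "\<lambda>\<xi>. snd (\<xi> k)"]) simp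
  then have "card (?C k) \<le> card (fibre x \<inter> U)"
    using f finite_fibre by (intro card_inj_on_le[of f]) auto
  then show "n \<le> count_on U x" using k unfolding count_on_def' by linarith
qed

lemma measurable_count_on_open:
  assumes "openin (boundary_topology I D rt) U"
  shows "(\<lambda>x. real (count_on U x)) \<in> borel_measurable borel"
proof (subst borel_measurable_iff_ge, intro allI)
  fix a :: real
  \<comment> \<open>Counts are natural numbers, so the threshold may be rounded up;
    \<open>nat\<close> sends a negative one to 0, where the condition always holds.\<close>
  define E where "E k = {x. nat \<lceil>a\<rceil> \<le> card
      {\<alpha> \<in> {\<alpha> \<in> I k. \<forall>\<xi>\<in>rays. \<xi> k = (k, \<alpha>) \<longrightarrow> \<xi> \<in> U}. x \<in> closure (D k \<alpha>)}}" for k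
  have E: "E k \<in> sets borel" if "fine_level k" for k
    unfolding E_def using that by (intro borel_closed closed_card_cubes) auto
  have "{x. a \<le> real (count_on U x)} = {x. nat \<lceil>a\<rceil> \<le> count_on U x}"
    by (simp add: nat_ceiling_le_eq)
  also have "\<dots> = (\<Union>k\<in>Collect fine_level. E k)"
    unfolding count_on_open_ge[OF assms] E_def by blast
  also have "\<dots> \<in> sets borel"
    using E by (intro sets.countable_UN') auto
  finally show "{x \<in> space borel. a \<le> real (count_on U x)} \<in> sets borel" by simp
qed

text \<open>Finite fibres turn complements into differences of counts, and disjoint unions become
  convergent series, so Dynkin's theorem extends the open case.\<close>

lemma measurable_count_on:
  assumes "A \<in> sets (boundary_borel I D rt)"
  shows "(\<lambda>x. real (count_on A x)) \<in> borel_measurable borel"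
proof -
  have "Int_stable {U. openin (boundary_topology I D rt) U}"
    by (auto intro!: Int_stableI)
  then show ?thesis
    using opens_Pow assms[unfolded sets_boundary_borel]
  proof (induction rule: sigma_sets_induct_disjoint)
    case (basic U)
    then show ?case by (simp add: measurable_count_on_open)
  next
    case empty
    then show ?case by (simp add: count_on_def')
  next
    case (compl A)
    have "openin (boundary_topology I D rt) rays"
      by (metis openin_topspace topspace_boundary_topology)
    moreover have "real (count_on (rays - A) x) = real (count_on rays x) - real (count_on A x)" for x
      unfolding count_on_eq_sum sum_subtractf[symmetric]
      by (rule sum.cong) (auto simp: indicator_def)
    ultimately show ?case
      using compl by (auto intro!: borel_measurable_diff measurable_count_on_open)
  next
    case (union A)
    then have "(\<lambda>x. \<Sum>i. real (count_on (A i) x)) \<in> borel_measurable borel"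
      by (intro borel_measurable_suminf) auto
    then show ?case
      using count_on_sums[OF union(1)] by (simp add: sums_iff)
  qed
qed

lemma fibre_card_eq: "fibre_card I D rt x = count_on rays x"
  unfolding fibre_card_def fibre_card_on_def by simp

text \<open>Surjectivity and finiteness of fibres together ensure that the ratio never divides by
  zero.\<close>

lemma fibre_card_pos: "0 < fibre_card I D rt x"
  unfolding fibre_card_def using finite_fibre Lam_onto[of x]
  by (subst card_gt_0_iff) blast

lemma rays_in_sets: "rays \<in> sets (boundary_borel I D rt)"
  by (metis sets.top space_boundary_borel)

lemma count_on_le: "count_on A x \<le> fibre_card I D rt x"
  unfolding count_on_def' fibre_card_def using finite_fibre by (intro card_mono) auto

lemma count_on_pos_iff: "A \<subseteq> rays \<Longrightarrow> 0 < count_on A x \<longleftrightarrow> x \<in> Lam D ` A"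
  unfolding count_on_def' using finite_fibre[of x] by (auto simp: card_gt_0_iff)

text \<open>Continuous images of Borel sets need not be Borel in general; here the image is where a
  Borel counting function is positive.\<close>

lemma Lam_image_borel:
  assumes "A \<in> sets (boundary_borel I D rt)"
  shows "Lam D ` A \<in> sets borel"
proof -
  have "A \<subseteq> rays" using sets.sets_into_space[OF assms] by (simp add: space_boundary_borel)
  then have "Lam D ` A = {x \<in> space borel. 0 < real (count_on A x)}"
    using count_on_pos_iff by auto
  also have "\<dots> \<in> sets borel"
    using measurable_count_on[OF assms] by measurable
  finally show ?thesis .
qed

section \<open>Supports and the pull-back measure\<close>

lemma supp_distr_Lam:
  fixes \<nu> :: "(nat \<Rightarrow> nat \<times> 'i) measure"
  assumes sets: "sets \<nu> = sets (boundary_borel I D rt)"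
  shows "supp euclidean (distr \<nu> borel (Lam D)) = Lam D ` supp (boundary_topology I D rt) \<nu>"
proof -
  note meas = measurable_Lam[OF sets]
  have space: "space \<nu> = rays"
    using sets_eq_imp_space_eq[OF sets] by (simp add: space_boundary_borel)
  have em: "emeasure (distr \<nu> borel (Lam D)) W = emeasure \<nu> (Lam D -` W \<inter> rays)" if "open W" for W
    using that by (simp add: emeasure_distr[OF meas] space)
  show ?thesis
  proof (intro equalityI subsetI)
    fix x assume "x \<in> Lam D ` supp (boundary_topology I D rt) \<nu>"
    then obtain \<xi> where \<xi>: "\<xi> \<in> rays" "x = Lam D \<xi>"
        "\<And>U. openin (boundary_topology I D rt) U \<Longrightarrow> \<xi> \<in> U \<Longrightarrow> 0 < emeasure \<nu> U"
      unfolding supp_def topspace_boundary_topology by blast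
    then show "x \<in> supp euclidean (distr \<nu> borel (Lam D))"
      unfolding supp_def using openin_Lam_vimage by (auto simp: em)
  next
    fix x assume x: "x \<in> supp euclidean (distr \<nu> borel (Lam D))"
    show "x \<in> Lam D ` supp (boundary_topology I D rt) \<nu>"
    proof (rule ccontr)
      assume neg: "\<not> ?thesis"
      \<comment> \<open>A ray outside the support has a null open neighbourhood, which contains all
        deep enough cylinders along it.\<close>
      have "eventually (\<lambda>k. emeasure \<nu> {\<eta> \<in> rays. \<eta> k = \<xi> k} = 0) sequentially"
        if fib: "\<xi> \<in> fibre x" for \<xi>
      proof -
        have "\<xi> \<notin> supp (boundary_topology I D rt) \<nu>" using neg fib by blast
        then obtain U where U: "openin (boundary_topology I D rt) U" "\<xi> \<in> U" "emeasure \<nu> U = 0"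
          using fib unfolding supp_def topspace_boundary_topology
          by (auto simp: zero_less_iff_neq_zero)
        show ?thesis
          using openin_imp_eventually[OF U(1,2)]
        proof eventually_elim
          case (elim k)
          then have "emeasure \<nu> {\<eta> \<in> rays. \<eta> k = \<xi> k} \<le> emeasure \<nu> U"
            using openin_in_sets[OF U(1)] sets by (intro emeasure_mono) auto
          then show ?case using U(3) by simp
        qed
      qed
      then have "eventually (\<lambda>k. fine_level k \<and> (\<forall>\<xi>\<in>fibre x. emeasure \<nu> {\<eta> \<in> rays. \<eta> k = \<xi> k} = 0)) sequentially"
        using fine_eventually finite_fibre[of x]
        by (intro eventually_conj eventually_ball_finite) auto
      then obtain k where k: "fine_level k" "\<And>\<xi>. \<xi> \<in> fibre x \<Longrightarrow> emeasure \<nu> {\<eta> \<in> rays. \<eta> k = \<xi> k} = 0"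
        using eventually_happens by force
      obtain W where W: "open W" "x \<in> W"
        "\<And>y \<alpha>. y \<in> W \<Longrightarrow> \<alpha> \<in> I k \<Longrightarrow> y \<in> closure (D k \<alpha>) \<Longrightarrow> x \<in> closure (D k \<alpha>)"
        using closure_locally[OF k(1)] by metis
      have cyl: "{\<eta> \<in> rays. \<eta> k = \<xi> k} \<in> sets \<nu>" if "\<xi> \<in> rays" for \<xi>
        using openin_in_sets[OF openin_cylinder[OF that]] sets by simp
      \<comment> \<open>A ray landing in \<open>W\<close> passes through a level \<open>k\<close>
        cube with \<open>x\<close> in its closure; some ray of the fibre over \<open>x\<close>
        passes through the same cube.\<close>
      have "Lam D -` W \<inter> rays \<subseteq> (\<Union>\<xi>\<in>fibre x. {\<eta> \<in> rays. \<eta> k = \<xi> k})"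
      proof
        fix \<eta> assume \<eta>: "\<eta> \<in> Lam D -` W \<inter> rays"
        then have "x \<in> closure (D k (snd (\<eta> k)))"
          using W(3)[of "Lam D \<eta>"] ray_index Lam_in by auto
        then obtain \<xi> where "\<xi> \<in> rays" "\<xi> k = (k, snd (\<eta> k))" "Lam D \<xi> = x"
          using ray_through[of "snd (\<eta> k)" k x] ray_index \<eta> by blast
        then show "\<eta> \<in> (\<Union>\<xi>\<in>fibre x. {\<eta> \<in> rays. \<eta> k = \<xi> k})"
          using \<eta> ray_level[of \<eta> k] by (auto simp: prod_eq_iff)
      qed
      then have "emeasure \<nu> (Lam D -` W \<inter> rays) \<le> emeasure \<nu> (\<Union>\<xi>\<in>fibre x. {\<eta> \<in> rays. \<eta> k = \<xi> k})"
        using cyl finite_fibre by (intro emeasure_mono sets.finite_UN) auto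
      also have "\<dots> \<le> (\<Sum>\<xi>\<in>fibre x. emeasure \<nu> {\<eta> \<in> rays. \<eta> k = \<xi> k})"
        using cyl finite_fibre by (intro emeasure_subadditive_finite) auto
      also have "\<dots> = 0" using k(2) by simp
      finally have "emeasure (distr \<nu> borel (Lam D)) W = 0" using W(1) by (simp add: em)
      then show False using x W unfolding supp_def by auto
    qed
  qed
qed

section \<open>The pull-back of a fixed Borel measure\<close>

context
  fixes \<omega> :: "'a measure"
  assumes sets_\<omega>: "sets \<omega> = sets borel"
begin

lemma measurable_ratio:
  assumes "A \<in> sets (boundary_borel I D rt)"
  shows "(\<lambda>x. ennreal (real (count_on A x) / real (fibre_card I D rt x))) \<in> borel_measurable \<omega>"
  unfolding measurable_cong_sets[OF sets_\<omega> refl] fibre_card_eq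
  using measurable_count_on[OF assms] measurable_count_on[OF rays_in_sets] by measurable

text \<open>The ratios are countably additive at each point, and nonnegative series of measurable
  functions may be integrated termwise.\<close>

lemma measure_space_pullback:
  "measure_space rays (sets (boundary_borel I D rt)) (pullback_fun I D rt \<omega>)"
proof -
  have "countably_additive (sets (boundary_borel I D rt)) (pullback_fun I D rt \<omega>)"
  proof (rule countably_additiveI)
    fix A :: "nat \<Rightarrow> (nat \<Rightarrow> nat \<times> 'i) set"
    assume A: "range A \<subseteq> sets (boundary_borel I D rt)" "disjoint_family A"
    have "(\<Sum>i. ennreal (real (count_on (A i) x) / real (fibre_card I D rt x)))
        = ennreal (real (count_on (\<Union>i. A i) x) / real (fibre_card I D rt x))" for x
      using sums_divide[OF count_on_sums[OF A(2), of x], of "real (fibre_card I D rt x)"]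
      by (intro suminf_ennreal_eq) auto
    then show "(\<Sum>i. pullback_fun I D rt \<omega> (A i)) = pullback_fun I D rt \<omega> (\<Union> (range A))"
      unfolding pullback_fun_def using A(1) measurable_ratio
      by (subst nn_integral_suminf[symmetric]) auto
  qed
  moreover have "positive (sets (boundary_borel I D rt)) (pullback_fun I D rt \<omega>)"
    by (simp add: positive_def pullback_fun_def count_on_def')
  moreover have "sigma_algebra rays (sets (boundary_borel I D rt))"
    using sets.sigma_algebra_axioms[of "boundary_borel I D rt"] by (simp add: space_boundary_borel)
  ultimately show ?thesis unfolding measure_space_def by blast
qed

lemma sets_pullback: "sets (pullback I D rt \<omega>) = sets (boundary_borel I D rt)"
  unfolding pullback_def
  using sigma_algebra.sigma_sets_eq[OF measure_space_pullback[unfolded measure_space_def, THEN conjunct1]]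
    sets.space_closed[of "boundary_borel I D rt"]
  by (simp add: space_boundary_borel)

lemma space_pullback: "space (pullback I D rt \<omega>) = rays"
  using sets_eq_imp_space_eq[OF sets_pullback] by (simp add: space_boundary_borel)

lemma emeasure_pullback:
  "A \<in> sets (boundary_borel I D rt) \<Longrightarrow> emeasure (pullback I D rt \<omega>) A = pullback_fun I D rt \<omega> A"
  using measure_space_pullback unfolding pullback_def measure_space_def
  by (intro emeasure_measure_of_sigma) auto

lemma distr_pullback: "distr (pullback I D rt \<omega>) borel (Lam D) = \<omega>"
proof (rule measure_eqI)
  note meas = measurable_Lam[OF sets_pullback]
  fix E assume "E \<in> sets (distr (pullback I D rt \<omega>) borel (Lam D))"
  then have E: "E \<in> sets borel" by simp
  then have pre: "Lam D -` E \<inter> rays \<in> sets (boundary_borel I D rt)"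
    using measurable_sets[OF meas E] by (simp add: sets_pullback space_pullback)
  \<comment> \<open>The preimage of \<open>E\<close> contains or misses each fibre entirely, so the
    ratio is the indicator of \<open>E\<close>.\<close>
  have "count_on (Lam D -` E \<inter> rays) x = (if x \<in> E then fibre_card I D rt x else 0)" for x
    unfolding fibre_card_def fibre_card_on_def
    by (auto intro!: arg_cong[where f = card] simp: card_eq_0_iff)
  then have "ennreal (real (count_on (Lam D -` E \<inter> rays) x) / real (fibre_card I D rt x))
      = indicator E x" for x
    using fibre_card_pos[of x] by (simp add: indicator_def)
  then have "pullback_fun I D rt \<omega> (Lam D -` E \<inter> rays) = emeasure \<omega> E"
    unfolding pullback_fun_def using E sets_\<omega> by simp
  then show "emeasure (distr (pullback I D rt \<omega>) borel (Lam D)) E = emeasure \<omega> E"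
    by (simp add: emeasure_distr[OF meas E] space_pullback emeasure_pullback[OF pre])
qed (simp add: sets_\<omega>)

text \<open>The ratio vanishes off the image of \<open>A\<close>; on it at least one preimage is
  counted, so the ratio lies between \<open>1 / N\<close> and \<open>1\<close>.\<close>

lemma pullback_bounds:
  assumes A: "A \<in> sets (boundary_borel I D rt)"
  shows "emeasure \<omega> (Lam D ` A) / of_nat (Max (range (fibre_card I D rt)))
      \<le> emeasure (pullback I D rt \<omega>) A"
    and "emeasure (pullback I D rt \<omega>) A \<le> emeasure \<omega> (Lam D ` A)"
proof -
  let ?N = "Max (range (fibre_card I D rt))"
  have Arays: "A \<subseteq> rays" using sets.sets_into_space[OF A] by (simp add: space_boundary_borel)
  have LA: "Lam D ` A \<in> sets \<omega>" using Lam_image_borel[OF A] sets_\<omega> by simp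
  \<comment> \<open>The uniform bound makes the range finite, so \<open>Max\<close> is a true
    maximum.\<close>
  have "range (fibre_card I D rt) \<subseteq> {..max_near}"
    using card_fibre_le by (auto simp: fibre_card_def)
  then have N: "fibre_card I D rt x \<le> ?N" for x
    by (intro Max_ge) (auto intro: finite_subset)
  then have Npos: "0 < ?N" using fibre_card_pos by (meson less_le_trans)
  have "emeasure \<omega> (Lam D ` A) / of_nat ?N = (\<integral>\<^sup>+x. indicator (Lam D ` A) x / of_nat ?N \<partial>\<omega>)"
    using LA by (simp add: nn_integral_divide)
  also have "\<dots> \<le> pullback_fun I D rt \<omega> A"
    unfolding pullback_fun_def
  proof (rule nn_integral_mono)
    fix x
    show "indicator (Lam D ` A) x / of_nat ?N
        \<le> ennreal (real (count_on A x) / real (fibre_card I D rt x))"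
    proof (cases "x \<in> Lam D ` A")
      case True
      then have "1 \<le> count_on A x" using count_on_pos_iff[OF Arays, of x] by simp
      then have "1 / real ?N \<le> real (count_on A x) / real (fibre_card I D rt x)"
        using N[of x] fibre_card_pos[of x] by (intro frac_le) auto
      then have "ennreal (1 / real ?N) \<le> ennreal (real (count_on A x) / real (fibre_card I D rt x))"
        by (rule ennreal_leI)
      moreover have "ennreal (1 / real ?N) = 1 / of_nat ?N"
        using Npos by (simp add: divide_ennreal[symmetric] ennreal_of_nat_eq_real_of_nat)
      ultimately show ?thesis using True by simp
    qed simp
  qed
  finally show "emeasure \<omega> (Lam D ` A) / of_nat ?N \<le> emeasure (pullback I D rt \<omega>) A"
    by (simp add: emeasure_pullback[OF A])
  have "pullback_fun I D rt \<omega> A \<le> (\<integral>\<^sup>+x. indicator (Lam D ` A) x \<partial>\<omega>)"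
    unfolding pullback_fun_def
  proof (rule nn_integral_mono)
    fix x
    show "ennreal (real (count_on A x) / real (fibre_card I D rt x)) \<le> indicator (Lam D ` A) x"
      using count_on_pos_iff[OF Arays, of x] count_on_le[of A x] fibre_card_pos[of x]
      by (cases "x \<in> Lam D ` A") (auto simp: divide_le_eq_1)
  qed
  then show "emeasure (pullback I D rt \<omega>) A \<le> emeasure \<omega> (Lam D ` A)"
    using LA by (simp add: emeasure_pullback[OF A])
qed

text \<open>The pull-back pushes forward to \<omega>, so the support formula applies to it; the two
  inclusions yield (iii) and (v).\<close>

lemma supp_pullback: "supp euclidean \<omega> = Lam D ` supp (boundary_topology I D rt) (pullback I D rt \<omega>)"
  using supp_distr_Lam[OF sets_pullback] by (simp add: distr_pullback)

end

end

theorem proposition16: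
  fixes m :: "'a::complete_space measure"
    and I :: "nat \<Rightarrow> 'i set"
    and D :: "nat \<Rightarrow> 'i \<Rightarrow> 'a set"
    and z :: "nat \<Rightarrow> 'i \<Rightarrow> 'a"
    and rt :: 'i
    and Q c1 c2 \<delta> a0 c4 :: real
    and \<omega> :: "'a measure"
  assumes "ahlfors_regular m Q c1 c2"
    and "dyadic_system m I D z rt \<delta> a0 c4"
    and "sets \<omega> = sets borel"
  shows "measure_space (tree_boundary I D rt) (sets (boundary_borel I D rt))
           (pullback_fun I D rt \<omega>) \<and>
         distr (pullback I D rt \<omega>) borel (Lam D) = \<omega> \<and>
         (\<forall>A \<in> sets (boundary_borel I D rt).
            emeasure \<omega> (Lam D ` A) / of_nat (Max (range (fibre_card I D rt)))
              \<le> emeasure (pullback I D rt \<omega>) A \<and>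
            emeasure (pullback I D rt \<omega>) A \<le> emeasure \<omega> (Lam D ` A)) \<and>
         supp (boundary_topology I D rt) (pullback I D rt \<omega>)
           \<subseteq> {\<xi> \<in> tree_boundary I D rt. Lam D \<xi> \<in> supp euclidean \<omega>} \<and>
         (\<forall>\<nu> :: (nat \<Rightarrow> nat \<times> 'i) measure. sets \<nu> = sets (boundary_borel I D rt) \<longrightarrow>
            supp euclidean (distr \<nu> borel (Lam D))
              = Lam D ` supp (boundary_topology I D rt) \<nu>) \<and>
         supp euclidean \<omega> \<subseteq> Lam D ` supp (boundary_topology I D rt) (pullback I D rt \<omega>)"
proof -
  interpret regular_dyadic_system m Q c1 c2 I D z rt \<delta> a0 c4
    using assms(1,2) by (rule regular_dyadic_system.intro)
  have "supp (boundary_topology I D rt) (pullback I D rt \<omega>)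
      \<subseteq> {\<xi> \<in> rays. Lam D \<xi> \<in> supp euclidean \<omega>}"
    unfolding supp_pullback[OF assms(3)] by (auto simp: supp_def topspace_boundary_topology)
  then show ?thesis
    using measure_space_pullback[OF assms(3)] distr_pullback[OF assms(3)]
      pullback_bounds[OF assms(3)] supp_distr_Lam supp_pullback[OF assms(3)]
    by blast
qed

end
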